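(* Let $d$ be a fixed positive integer, $0<\delta<2$ and $\lambda>d$. Let $\mathcal{C}(t;\delta,\lambda)=(1+t^{\delta})^{-\lambda/\delta}$, $t\ge0$, be the Generalized Cauchy function. Let $0<\beta_1<\beta_2$ and, for $\varepsilon\in\mathbb{R}$, $\varepsilon\neq0$, let $$K_{\varepsilon;\delta,\lambda;\beta_2,\beta_1}[\mathcal{C}](t)=\frac{\beta_2^{\varepsilon}\mathcal{C}(t/\beta_2;\delta,\lambda)-\beta_1^{\varepsilon}\mathcal{C}(t/\beta_1;\delta,\lambda)}{\beta_2^{\varepsilon}-\beta_1^{\varepsilon}},\qquad t\ge0.$$ 1. Let $\varepsilon>0$. If $\varepsilon\ge\delta>0$ and $\delta<1$, then $K_{\varepsilon;\delta,\lambda;\beta_2,\beta_1}[\mathcal{C}]\in\Phi_\infty$. 2. Let $\varepsilon<0$. Then $K_{\varepsilon;\delta,\lambda;\beta_2,\beta_1}[\mathcal{C}]\in\Phi_\infty$ if and only if $\varepsilon\le-\lambda<0$.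
   Context: For a positive integer $n$, $\Phi_n$ is the class of continuous functions $\phi:[0,\infty)\to\mathbb{R}$ with $\phi(0)=1$ such that $\boldsymbol x\mapsto\phi(\|\boldsymbol x\|)$ is positive definite on $\mathbb{R}^n$; here $f:\mathbb{R}^n\to\mathbb{R}$ is positive definite if $\sum_{k=1}^N\sum_{h=1}^N a_k f(\boldsymbol x_k-\boldsymbol x_h)a_h\ge0$ for every finite collection $a_1,\dots,a_N\in\mathbb{R}$ and points $\boldsymbol x_1,\dots,\boldsymbol x_N\in\mathbb{R}^n$. $\Phi_\infty=\bigcap_{n\ge1}\Phi_n$. *)

theory Defs
  imports "HOL-Analysis.Analysis"
begin

text \<open>
  Since the dimension is quantified over, n-dimensional real space is
  \<^term>\<open>topspace (Euclidean_space n)\<close>: the sequences vanishing at all indices \<open>i \<ge> n\<close>.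
\<close>

definition positive_definite_on :: "nat \<Rightarrow> ((nat \<Rightarrow> real) \<Rightarrow> real) \<Rightarrow> bool" where
  "positive_definite_on n f \<longleftrightarrow>
     (\<forall>N. \<forall>a :: nat \<Rightarrow> real. \<forall>x :: nat \<Rightarrow> nat \<Rightarrow> real.
        (\<forall>k<N. x k \<in> topspace (Euclidean_space n)) \<longrightarrow>
        (\<Sum>k<N. \<Sum>h<N. a k * f (\<lambda>i. x k i - x h i) * a h) \<ge> 0)"

text \<open>
  Membership only depends on the values of \<open>\<phi>\<close> on \<open>[0, \<infinity>)\<close>, so elements
  are represented by total functions on the reals.
\<close>

definition Phi :: "nat \<Rightarrow> (real \<Rightarrow> real) set" where
  "Phi n = {\<phi>. continuous_on {0..} \<phi> \<and> \<phi> 0 = 1 \<and>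
                positive_definite_on n (\<lambda>x. \<phi> (L2_set x {..<n}))}"

definition Phi_inf :: "(real \<Rightarrow> real) set" where
  "Phi_inf = (\<Inter>n\<in>{1..}. Phi n)"

definition gen_cauchy :: "real \<Rightarrow> real \<Rightarrow> real \<Rightarrow> real" where
  "gen_cauchy \<delta> lam t = (1 + t powr \<delta>) powr (- lam / \<delta>)"

text \<open>
  The operator is meaningful for \<open>\<epsilon> \<noteq> 0\<close> and \<open>0 < \<beta>1 < \<beta>2\<close>; the order of the
  arguments \<open>\<beta>2\<close>, \<open>\<beta>1\<close> follows the subscripts in \<open>K_{\<epsilon>; \<dots>; \<beta>2, \<beta>1}\<close>.
\<close>

definition K_op :: "real \<Rightarrow> real \<Rightarrow> real \<Rightarrow> (real \<Rightarrow> real) \<Rightarrow> real \<Rightarrow> real" where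
  "K_op \<epsilon> \<beta>2 \<beta>1 \<phi> t =
     (\<beta>2 powr \<epsilon> * \<phi> (t / \<beta>2) - \<beta>1 powr \<epsilon> * \<phi> (t / \<beta>1)) / (\<beta>2 powr \<epsilon> - \<beta>1 powr \<epsilon>)"

end

theory Submission
  imports Defs
begin

text \<open>
  Write \<open>p = lam / \<delta>\<close> and \<open>F \<beta> = \<beta>\<^sup>\<epsilon> C(r / \<beta>)\<close> for a fixed distance \<open>r\<close>, where \<open>C\<close> is the
  Cauchy function. The operator is a quotient of increments,
  \<open>(F \<beta>2 - F \<beta>1) / (\<beta>2\<^sup>\<epsilon> - \<beta>1\<^sup>\<epsilon>)\<close>, and its denominator has the sign of \<open>\<epsilon>\<close>. Positive definite
  kernels form a closed convex cone, so membership in \<open>Phi_inf\<close> follows once \<open>sgn \<epsilon> * F' \<beta>\<close> is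
  positive definite for every \<open>\<beta>\<close>. With \<open>y = (r / \<beta>)\<^sup>\<delta>\<close>,
  \<open>\<beta>\<^sup>1\<^sup>-\<^sup>\<epsilon> F' \<beta> = (\<epsilon> + lam) (1 + y)\<^sup>-\<^sup>p - lam (1 + y)\<^sup>-\<^sup>p\<^sup>-\<^sup>1\<close>.

  If \<open>\<epsilon> \<le> - lam\<close>, the negative of this expression is a nonnegative combination of functions
  \<open>(1 + y)\<^sup>-\<^sup>q\<close>, each of them positive definite because \<open>r\<^sup>\<delta>\<close> is a negative definite kernel for
  \<open>0 < \<delta> < 2\<close>. If \<open>\<epsilon> \<ge> \<delta>\<close>, it equals \<open>(\<epsilon> - \<delta>) (1 + y)\<^sup>-\<^sup>p + \<delta> H y\<close> with
  \<open>H y = (p + 1) (1 + y)\<^sup>-\<^sup>p - p (1 + y)\<^sup>-\<^sup>p\<^sup>-\<^sup>1\<close>. Here \<open>H\<close> vanishes at infinity and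
  \<open>H' \<rho> = - p (p + 1) \<rho> (1 + \<rho>)\<^sup>-\<^sup>p\<^sup>-\<^sup>2\<close>; substituting \<open>\<rho> = \<surd>(y\<^sup>2 + b)\<close> absorbs the factor \<open>\<rho>\<close>, so
  \<open>H y\<close> is half of \<open>p (p + 1)\<close> times the integral of \<open>(1 + \<surd>(y\<^sup>2 + b))\<^sup>-\<^sup>p\<^sup>-\<^sup>2\<close> over \<open>b > 0\<close>. The
  condition \<open>\<delta> < 1\<close> makes \<open>y\<^sup>2\<close>, a multiple of \<open>r\<^sup>2\<^sup>\<delta>\<close>, negative definite, hence \<open>\<surd>(y\<^sup>2 + b)\<close> as
  well, and the integrand is positive definite.

  For the converse, a function in \<open>Phi_inf\<close> is nonnegative, since \<open>R\<^sup>n\<close> contains arbitrarily many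
  points at equal mutual distance as \<open>n\<close> grows. But \<open>t powr lam * C(t / \<beta>)\<close> tends to
  \<open>\<beta> powr lam\<close>, so for \<open>- lam < \<epsilon> < 0\<close> the numerator is eventually positive, while the denominator is negative.

  Integrals over a parameter are expressed through monotonicity of the quadratic form along a
  differentiable family (\<open>schur_mult_increment\<close>), and powers of kernels through binomial series with
  coefficients of constant sign (\<open>neg_def_powr\<close>, \<open>schur_mult_one_plus_neg_powr\<close>).
\<close>

section \<open>Schur multipliers\<close>

definition psd :: "'i set \<Rightarrow> ('i \<Rightarrow> 'i \<Rightarrow> real) \<Rightarrow> bool" where
  "psd I K \<longleftrightarrow> (\<forall>a. (\<Sum>k\<in>I. \<Sum>h\<in>I. a k * K k h * a h) \<ge> 0)"

text \<open>
  By the Schur product theorem, the symmetric kernels of this kind are exactly the symmetric positive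
  semidefinite ones. In the multiplier form closure under products is immediate, and all kernels
  below are generated from rank one kernels.
\<close>

definition schur_mult :: "'i set \<Rightarrow> ('i \<Rightarrow> 'i \<Rightarrow> real) \<Rightarrow> bool" where
  "schur_mult I F \<longleftrightarrow> (\<forall>K. psd I K \<longrightarrow> psd I (\<lambda>k h. F k h * K k h))"

text \<open>
  Schoenberg's exponential characterisation of negative definite kernels, taken as definition.
  Distances enter the proof through these kernels, because they are stable under fractional powers.
\<close>

definition neg_def :: "'i set \<Rightarrow> ('i \<Rightarrow> 'i \<Rightarrow> real) \<Rightarrow> bool" where
  "neg_def I N \<longleftrightarrow> (\<forall>u\<ge>0. schur_mult I (\<lambda>k h. exp (- u * N k h)))"

lemma psd_cong:
  assumes "psd I F" "\<And>k h. k \<in> I \<Longrightarrow> h \<in> I \<Longrightarrow> F k h = G k h"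
  shows "psd I G"
proof -
  have "(\<Sum>k\<in>I. \<Sum>h\<in>I. a k * G k h * a h) = (\<Sum>k\<in>I. \<Sum>h\<in>I. a k * F k h * a h)" for a
    by (intro sum.cong refl) (simp add: assms(2))
  with assms(1) show ?thesis by (simp add: psd_def)
qed

lemma psd_add:
  assumes "psd I F" "psd I G"
  shows "psd I (\<lambda>k h. F k h + G k h)"
  unfolding psd_def
proof
  fix a
  have "(\<Sum>k\<in>I. \<Sum>h\<in>I. a k * (F k h + G k h) * a h)
      = (\<Sum>k\<in>I. \<Sum>h\<in>I. a k * F k h * a h) + (\<Sum>k\<in>I. \<Sum>h\<in>I. a k * G k h * a h)"
    by (simp add: algebra_simps sum.distrib)
  with assms show "0 \<le> (\<Sum>k\<in>I. \<Sum>h\<in>I. a k * (F k h + G k h) * a h)"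
    by (simp add: psd_def)
qed

lemma psd_limit:
  assumes "\<And>n. psd I (F n)"
    and "\<And>k h. k \<in> I \<Longrightarrow> h \<in> I \<Longrightarrow> (\<lambda>n. F n k h) \<longlonglongrightarrow> G k h"
  shows "psd I G"
  unfolding psd_def
proof
  fix a
  have "(\<lambda>n. \<Sum>k\<in>I. \<Sum>h\<in>I. a k * F n k h * a h) \<longlonglongrightarrow> (\<Sum>k\<in>I. \<Sum>h\<in>I. a k * G k h * a h)"
    by (intro tendsto_sum tendsto_mult tendsto_const assms(2))
  then show "0 \<le> (\<Sum>k\<in>I. \<Sum>h\<in>I. a k * G k h * a h)"
    using assms(1) by (intro LIMSEQ_le_const) (auto simp: psd_def)
qed

text \<open>
  The all-ones kernel is positive semidefinite: its quadratic form is the square of a sum.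
\<close>

lemma schur_mult_imp_psd:
  assumes "schur_mult I F"
  shows "psd I F"
proof -
  have "(\<Sum>k\<in>I. \<Sum>h\<in>I. a k * 1 * a h) = (\<Sum>k\<in>I. a k)\<^sup>2" for a :: "'a \<Rightarrow> real"
    by (simp add: power2_eq_square sum_product)
  then have "psd I (\<lambda>_ _. 1)" by (simp add: psd_def)
  then have "psd I (\<lambda>k h. F k h * 1)"
    using assms unfolding schur_mult_def by blast
  then show ?thesis by simp
qed

lemma schur_mult_cong:
  assumes "schur_mult I F" "\<And>k h. k \<in> I \<Longrightarrow> h \<in> I \<Longrightarrow> F k h = G k h"
  shows "schur_mult I G"
  using assms unfolding schur_mult_def by (metis (no_types, lifting) psd_cong)

text \<open>
  The factors \<open>c k\<close> and \<open>c h\<close> can be absorbed into the coefficients of the quadratic form.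
\<close>

lemma schur_mult_rank_one: "schur_mult I (\<lambda>k h. c k * c h)"
  unfolding schur_mult_def psd_def
proof (intro allI impI)
  fix K :: "'a \<Rightarrow> 'a \<Rightarrow> real" and a :: "'a \<Rightarrow> real"
  assume "\<forall>a. 0 \<le> (\<Sum>k\<in>I. \<Sum>h\<in>I. a k * K k h * a h)"
  then have "0 \<le> (\<Sum>k\<in>I. \<Sum>h\<in>I. (a k * c k) * K k h * (a h * c h))"
    by (rule spec)
  then show "0 \<le> (\<Sum>k\<in>I. \<Sum>h\<in>I. a k * (c k * c h * K k h) * a h)"
    by (simp add: mult_ac)
qed

lemma schur_mult_const:
  assumes "0 \<le> c"
  shows "schur_mult I (\<lambda>_ _. c)"
  using schur_mult_rank_one[of I "\<lambda>_. sqrt c"] assms by simp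

lemma schur_mult_add:
  assumes "schur_mult I F" "schur_mult I G"
  shows "schur_mult I (\<lambda>k h. F k h + G k h)"
  using assms unfolding schur_mult_def by (simp add: distrib_right psd_add)

lemma schur_mult_mult:
  assumes "schur_mult I F" "schur_mult I G"
  shows "schur_mult I (\<lambda>k h. F k h * G k h)"
  using assms unfolding schur_mult_def by (simp add: mult.assoc)

lemma schur_mult_scale:
  assumes "0 \<le> c" "schur_mult I F"
  shows "schur_mult I (\<lambda>k h. c * F k h)"
  using assms by (intro schur_mult_mult schur_mult_const)

lemma schur_mult_power:
  assumes "schur_mult I F"
  shows "schur_mult I (\<lambda>k h. F k h ^ n)"
  by (induction n) (auto intro!: schur_mult_mult schur_mult_const assms)

lemma schur_mult_sum:
  assumes "\<And>j. j \<in> J \<Longrightarrow> schur_mult I (F j)"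
  shows "schur_mult I (\<lambda>k h. \<Sum>j\<in>J. F j k h)"
  using assms
  by (induction J rule: infinite_finite_induct) (auto intro!: schur_mult_add schur_mult_const)

lemma schur_mult_limit:
  assumes "\<And>n. schur_mult I (F n)"
    and "\<And>k h. k \<in> I \<Longrightarrow> h \<in> I \<Longrightarrow> (\<lambda>n. F n k h) \<longlonglongrightarrow> G k h"
  shows "schur_mult I G"
  unfolding schur_mult_def
proof (intro allI impI)
  fix K assume K: "psd I K"
  show "psd I (\<lambda>k h. G k h * K k h)"
  proof (rule psd_limit)
    show "psd I (\<lambda>k h. F n k h * K k h)" for n
      using assms(1)[of n] K unfolding schur_mult_def by blast
    show "(\<lambda>n. F n k h * K k h) \<longlonglongrightarrow> G k h * K k h" if "k \<in> I" "h \<in> I" for k h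
      using assms(2)[OF that] by (intro tendsto_intros)
  qed
qed

text \<open>
  The source of all nonlinear examples: the exponential, the geometric and the binomial series
  are composed with a multiplier through their partial sums.
\<close>

lemma schur_mult_power_series:
  assumes "schur_mult I F" "\<And>n. 0 \<le> c n"
    and "\<And>k h. k \<in> I \<Longrightarrow> h \<in> I \<Longrightarrow> (\<lambda>n. c n * F k h ^ n) sums G k h"
  shows "schur_mult I G"
proof (rule schur_mult_limit)
  show "schur_mult I (\<lambda>k h. \<Sum>j<n. c j * F k h ^ j)" for n
    using assms(1,2) by (intro schur_mult_sum schur_mult_scale schur_mult_power)
qed (use assms(3) in \<open>simp add: sums_def\<close>)

lemma schur_mult_exp:
  assumes "schur_mult I F"
  shows "schur_mult I (\<lambda>k h. exp (F k h))"
proof (rule schur_mult_power_series[OF assms, where c = "\<lambda>n. inverse (fact n)"])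
  show "(\<lambda>n. inverse (fact n) * F k h ^ n) sums exp (F k h)" for k h
    using exp_converges[of "F k h"] by simp
qed simp

text \<open>
  The quadratic form of the family \<open>G b\<close>, multiplied entrywise by a positive semidefinite kernel,
  is a real function of \<open>b\<close> with nonnegative derivative, hence nondecreasing. This plays the role of
  closure under integration. The derivative is demanded only in the interior, since the square root
  that occurs below has none at zero.
\<close>

lemma schur_mult_increment:
  assumes "s < t"
    and cont: "\<And>k h. k \<in> I \<Longrightarrow> h \<in> I \<Longrightarrow> continuous_on {s..t} (\<lambda>b. G b k h)"
    and deriv: "\<And>b k h. s < b \<Longrightarrow> b < t \<Longrightarrow> k \<in> I \<Longrightarrow> h \<in> I \<Longrightarrow>
        ((\<lambda>b. G b k h) has_real_derivative G' b k h) (at b)"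
    and mult: "\<And>b. s < b \<Longrightarrow> b < t \<Longrightarrow> schur_mult I (G' b)"
  shows "schur_mult I (\<lambda>k h. G t k h - G s k h)"
  unfolding schur_mult_def
proof (intro allI impI)
  fix K assume K: "psd I K"
  show "psd I (\<lambda>k h. (G t k h - G s k h) * K k h)"
    unfolding psd_def
  proof
    fix a
    define Q where "Q b = (\<Sum>k\<in>I. \<Sum>h\<in>I. a k * (G b k h * K k h) * a h)" for b
    have "Q s \<le> Q t"
    proof (rule DERIV_nonneg_imp_increasing_open[where f = Q])
      fix b assume b: "s < b" "b < t"
      have "(Q has_real_derivative (\<Sum>k\<in>I. \<Sum>h\<in>I. a k * (G' b k h * K k h) * a h)) (at b)"
        unfolding Q_def using b by (auto intro!: DERIV_sum derivative_eq_intros deriv)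
      moreover have "0 \<le> (\<Sum>k\<in>I. \<Sum>h\<in>I. a k * (G' b k h * K k h) * a h)"
        using mult[OF b] K unfolding schur_mult_def psd_def by blast
      ultimately show "\<exists>y. (Q has_real_derivative y) (at b) \<and> 0 \<le> y" by blast
    next
      show "continuous_on {s..t} Q"
        unfolding Q_def by (intro continuous_intros cont)
    qed (use \<open>s < t\<close> in simp)
    moreover have "(\<Sum>k\<in>I. \<Sum>h\<in>I. a k * ((G t k h - G s k h) * K k h) * a h) = Q t - Q s"
      unfolding Q_def by (simp add: algebra_simps sum_subtractf)
    ultimately show "0 \<le> (\<Sum>k\<in>I. \<Sum>h\<in>I. a k * ((G t k h - G s k h) * K k h) * a h)" by simp
  qed
qed

section \<open>Negative definite kernels\<close>

text \<open>
  \<open>exp (- u (c - F)) = exp (- u c) exp (u F)\<close>, and the exponential series has positive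
  coefficients.
\<close>

lemma neg_def_const_minus:
  assumes "schur_mult I F"
  shows "neg_def I (\<lambda>k h. c - F k h)"
  unfolding neg_def_def
proof (intro allI impI)
  fix u :: real assume "0 \<le> u"
  then have "schur_mult I (\<lambda>k h. exp (- u * c) * exp (u * F k h))"
    using assms by (intro schur_mult_scale schur_mult_exp) auto
  then show "schur_mult I (\<lambda>k h. exp (- u * (c - F k h)))"
    by (simp add: algebra_simps flip: exp_add)
qed

lemma neg_def_scale:
  assumes "0 \<le> c" "neg_def I N"
  shows "neg_def I (\<lambda>k h. c * N k h)"
  unfolding neg_def_def
proof (intro allI impI)
  fix u :: real assume "0 \<le> u"
  with assms have "schur_mult I (\<lambda>k h. exp (- (u * c) * N k h))"
    unfolding neg_def_def by (meson mult_nonneg_nonneg)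
  then show "schur_mult I (\<lambda>k h. exp (- u * (c * N k h)))" by (simp add: mult.assoc)
qed

lemma neg_def_add_const:
  assumes "neg_def I N"
  shows "neg_def I (\<lambda>k h. N k h + c)"
  unfolding neg_def_def
proof (intro allI impI)
  fix u :: real assume "0 \<le> u"
  with assms have "schur_mult I (\<lambda>k h. exp (- u * c) * exp (- u * N k h))"
    unfolding neg_def_def by (intro schur_mult_scale) auto
  then show "schur_mult I (\<lambda>k h. exp (- u * (N k h + c)))"
    by (simp add: algebra_simps flip: exp_add)
qed

lemma neg_def_limit:
  assumes "\<And>n. neg_def I (N n)"
    and "\<And>k h. k \<in> I \<Longrightarrow> h \<in> I \<Longrightarrow> (\<lambda>n. N n k h) \<longlonglongrightarrow> M k h"
  shows "neg_def I M"
  unfolding neg_def_def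
proof (intro allI impI)
  fix u :: real assume "0 \<le> u"
  show "schur_mult I (\<lambda>k h. exp (- u * M k h))"
  proof (rule schur_mult_limit)
    show "schur_mult I (\<lambda>k h. exp (- u * N n k h))" for n
      using assms(1)[of n] \<open>0 \<le> u\<close> unfolding neg_def_def by blast
    show "(\<lambda>n. exp (- u * N n k h)) \<longlonglongrightarrow> exp (- u * M k h)" if "k \<in> I" "h \<in> I" for k h
      using assms(2)[OF that] by (intro tendsto_intros)
  qed
qed

lemma neg_def_cong:
  assumes "neg_def I N" "\<And>k h. k \<in> I \<Longrightarrow> h \<in> I \<Longrightarrow> N k h = M k h"
  shows "neg_def I M"
  by (rule neg_def_limit[where N = "\<lambda>_. N"]) (use assms in auto)

text \<open>
  Expanding the square splits the Gaussian kernel into a rank one kernel and the exponential of a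
  nonnegative multiple of the inner product, which is a sum of rank one kernels.
\<close>

lemma neg_def_dist_squared:
  fixes x :: "'i \<Rightarrow> 'j \<Rightarrow> real"
  shows "neg_def I (\<lambda>k h. \<Sum>i\<in>A. (x k i - x h i)\<^sup>2)"
  unfolding neg_def_def
proof (intro allI impI)
  fix u :: real assume "0 \<le> u"
  define c where "c k = exp (- u * (\<Sum>i\<in>A. (x k i)\<^sup>2))" for k
  have "schur_mult I (\<lambda>k h. (c k * c h) * exp (2 * u * (\<Sum>i\<in>A. x k i * x h i)))"
    using \<open>0 \<le> u\<close>
    by (intro schur_mult_mult schur_mult_rank_one schur_mult_exp schur_mult_scale schur_mult_sum) auto
  moreover have "(c k * c h) * exp (2 * u * (\<Sum>i\<in>A. x k i * x h i))
      = exp (- u * (\<Sum>i\<in>A. (x k i - x h i)\<^sup>2))" for k h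
  proof -
    have "(\<Sum>i\<in>A. (x k i - x h i)\<^sup>2)
        = (\<Sum>i\<in>A. (x k i)\<^sup>2) + (\<Sum>i\<in>A. (x h i)\<^sup>2) - 2 * (\<Sum>i\<in>A. x k i * x h i)"
      by (simp add: power2_diff sum_subtractf sum.distrib sum_distrib_left mult.assoc)
    then show ?thesis
      by (simp add: c_def ring_distribs mult.assoc flip: exp_add)
  qed
  ultimately show "schur_mult I (\<lambda>k h. exp (- u * (\<Sum>i\<in>A. (x k i - x h i)\<^sup>2)))" by simp
qed

section \<open>Fractional powers of negative definite kernels\<close>

text \<open>
  A negative definite kernel \<open>N\<close> is thus a limit of kernels \<open>m (1 - F)\<close> with multipliers
  \<open>F = exp (- N / m)\<close>. Powers of \<open>1 - F\<close> expand in powers of \<open>F\<close>, which reduces power functions of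
  \<open>N\<close> to binomial series.
\<close>

lemma scaled_one_minus_exp_tendsto:
  "(\<lambda>m. real (Suc m) * (1 - exp (- (1 / real (Suc m)) * x))) \<longlonglongrightarrow> x"
proof -
  have "((\<lambda>u. (1 - exp (- u * x)) / u) \<longlongrightarrow> x) (at_right 0)"
  proof -
    have "((\<lambda>u. 1 - exp (- u * x)) has_real_derivative x) (at 0)"
      by (auto intro!: derivative_eq_intros)
    then have "((\<lambda>u. (1 - exp (- u * x)) / u) \<longlongrightarrow> x) (at 0)"
      by (simp add: has_field_derivative_iff)
    then show ?thesis by (simp add: filterlim_at_split)
  qed
  moreover have "filterlim (\<lambda>m. 1 / real (Suc m)) (at_right 0) sequentially"
    unfolding filterlim_at using LIMSEQ_inverse_real_of_nat
    by (auto simp: inverse_eq_divide intro!: always_eventually)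
  ultimately have "(\<lambda>m. (1 - exp (- (1 / real (Suc m)) * x)) / (1 / real (Suc m))) \<longlonglongrightarrow> x"
    by (rule filterlim_compose)
  then show ?thesis by (simp add: mult.commute)
qed

lemma gbinomial_Suc_ratio:
  fixes a :: real
  shows "a gchoose Suc n = (a gchoose n) * ((a - real n) / real (Suc n))"
  using gbinomial_mult_1[of a n] by (simp add: field_simps)

text \<open>
  For \<open>0 < \<alpha> < 1\<close> all nonconstant coefficients of \<open>(1 - z)\<^sup>\<alpha>\<close> are nonpositive: passing from one
  to the next multiplies by \<open>(n - \<alpha>) / (n + 1)\<close>, which is negative only for the step from \<open>n = 0\<close>.
\<close>

lemma gbinomial_alternating_nonneg:
  fixes \<alpha> :: real
  assumes "0 < \<alpha>" "\<alpha> < 1"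
  shows "0 \<le> - ((\<alpha> gchoose Suc n) * (-1) ^ Suc n)"
proof (induction n)
  case 0
  then show ?case using assms by simp
next
  case (Suc n)
  have "- ((\<alpha> gchoose Suc (Suc n)) * (-1) ^ Suc (Suc n))
      = - ((\<alpha> gchoose Suc n) * (-1) ^ Suc n) * ((real (Suc n) - \<alpha>) / real (Suc (Suc n)))"
    unfolding gbinomial_Suc_ratio[of \<alpha> "Suc n"] by (simp add: field_simps)
  moreover have "0 \<le> (real (Suc n) - \<alpha>) / real (Suc (Suc n))"
    using assms by simp
  ultimately show ?case
    using Suc by (metis mult_nonneg_nonneg)
qed

lemma gbinomial_neg_alternating_nonneg:
  fixes q :: real
  assumes "0 < q"
  shows "0 \<le> (- q gchoose n) * (-1) ^ n"
proof (induction n)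
  case (Suc n)
  have "(- q gchoose Suc n) * (-1) ^ Suc n
      = (- q gchoose n) * (-1) ^ n * ((q + real n) / real (Suc n))"
    unfolding gbinomial_Suc_ratio by (simp add: field_simps)
  moreover have "0 \<le> (q + real n) / real (Suc n)"
    using assms by simp
  ultimately show ?case
    using Suc by (metis mult_nonneg_nonneg)
qed simp

lemma schur_mult_one_minus_powr:
  assumes F: "schur_mult I F" "\<And>k h. k \<in> I \<Longrightarrow> h \<in> I \<Longrightarrow> \<bar>F k h\<bar> < 1"
    and \<alpha>: "0 < \<alpha>" "\<alpha> < 1"
  shows "schur_mult I (\<lambda>k h. 1 - (1 - F k h) powr \<alpha>)"
proof (rule schur_mult_power_series[OF F(1)])
  define c where "c n = (if n = 0 then 0 else - ((\<alpha> gchoose n) * (-1) ^ n))" for n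
  show "0 \<le> c n" for n
    unfolding c_def using gbinomial_alternating_nonneg[OF \<alpha>] by (cases n) auto
  fix k h assume kh: "k \<in> I" "h \<in> I"
  have "(\<lambda>n. (\<alpha> gchoose n) * (- F k h) ^ n) sums (1 + - F k h) powr \<alpha>"
    using F(2)[OF kh] by (intro gen_binomial_real) simp
  then have "(\<lambda>n. (if n = 0 then 1 else 0) - (\<alpha> gchoose n) * (- F k h) ^ n) sums (1 - (1 - F k h) powr \<alpha>)"
    using sums_single[of 0 "\<lambda>_. 1 :: real"] by (intro sums_diff) simp_all
  moreover have "(if n = 0 then 1 else 0) - (\<alpha> gchoose n) * (- F k h) ^ n = c n * F k h ^ n" for n
    by (simp add: c_def power_minus[of "F k h"])
  ultimately show "(\<lambda>n. c n * F k h ^ n) sums (1 - (1 - F k h) powr \<alpha>)" by simp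
qed

lemma schur_mult_one_minus_neg_powr:
  assumes F: "schur_mult I F" "\<And>k h. k \<in> I \<Longrightarrow> h \<in> I \<Longrightarrow> \<bar>F k h\<bar> < 1"
    and q: "0 < q"
  shows "schur_mult I (\<lambda>k h. (1 - F k h) powr (- q))"
proof (rule schur_mult_power_series[OF F(1) gbinomial_neg_alternating_nonneg[OF q]])
  fix k h assume "k \<in> I" "h \<in> I"
  then have "(\<lambda>n. (- q gchoose n) * (- F k h) ^ n) sums (1 + - F k h) powr (- q)"
    using F(2) by (intro gen_binomial_real) simp
  then show "(\<lambda>n. (- q gchoose n) * (-1) ^ n * F k h ^ n) sums (1 - F k h) powr (- q)"
    by (simp add: power_minus[of "F k h"] mult.assoc)
qed

text \<open>
  The series for \<open>(1 - F)\<^sup>\<alpha>\<close> shows that this kernel is one minus a multiplier; rescaling gives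
  \<open>(m (1 - F))\<^sup>\<alpha>\<close>, which tends to the power of \<open>N\<close>.
\<close>

lemma neg_def_powr:
  assumes N: "neg_def I N" "\<And>k h. k \<in> I \<Longrightarrow> h \<in> I \<Longrightarrow> 0 \<le> N k h"
    and \<alpha>: "0 < \<alpha>" "\<alpha> < 1"
  shows "neg_def I (\<lambda>k h. N k h powr \<alpha>)"
proof -
  \<comment> \<open>A positive shift keeps \<open>F\<close> strictly below 1, inside the disc of convergence, also where
    \<open>N\<close> vanishes.\<close>
  have pos: "neg_def I (\<lambda>k h. (N k h + c) powr \<alpha>)" if "0 < c" for c
  proof (rule neg_def_limit)
    define F where "F m k h = exp (- (1 / real (Suc m)) * (N k h + c))" for m k h
    have F: "schur_mult I (F m)" for m
      using neg_def_add_const[OF N(1), of c] unfolding neg_def_def F_def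
      by (elim allE[of _ "1 / real (Suc m)"]) simp
    have "\<bar>F m k h\<bar> < 1" if "k \<in> I" "h \<in> I" for m k h
      using N(2)[OF that] \<open>0 < c\<close> unfolding F_def abs_exp_cancel exp_less_one_iff by (simp add: divide_simps)
    then have "schur_mult I (\<lambda>k h. 1 - (1 - F m k h) powr \<alpha>)" for m
      by (intro schur_mult_one_minus_powr F \<alpha>)
    from neg_def_const_minus[OF this, of 1]
    have "neg_def I (\<lambda>k h. (1 - F m k h) powr \<alpha>)" for m by simp
    then show "neg_def I (\<lambda>k h. real (Suc m) powr \<alpha> * (1 - F m k h) powr \<alpha>)" for m
      by (intro neg_def_scale) simp_all
    fix k h assume kh: "k \<in> I" "h \<in> I"
    have "(\<lambda>m. (real (Suc m) * (1 - F m k h)) powr \<alpha>) \<longlonglongrightarrow> (N k h + c) powr \<alpha>"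
      unfolding F_def using N(2)[OF kh] \<open>0 < c\<close>
      by (intro tendsto_powr scaled_one_minus_exp_tendsto tendsto_const) simp
    moreover have "F m k h \<le> 1" for m
      using N(2)[OF kh] \<open>0 < c\<close> unfolding F_def by simp
    ultimately show "(\<lambda>m. real (Suc m) powr \<alpha> * (1 - F m k h) powr \<alpha>) \<longlonglongrightarrow> (N k h + c) powr \<alpha>"
      by (simp add: powr_mult)
  qed
  show ?thesis
  proof (rule neg_def_limit)
    show "neg_def I (\<lambda>k h. (N k h + inverse (real (Suc m))) powr \<alpha>)" for m
      by (rule pos) simp
    fix k h assume kh: "k \<in> I" "h \<in> I"
    have "(\<lambda>m. N k h + inverse (real (Suc m))) \<longlonglongrightarrow> N k h + 0"
      by (intro tendsto_intros LIMSEQ_inverse_real_of_nat)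
    then show "(\<lambda>m. (N k h + inverse (real (Suc m))) powr \<alpha>) \<longlonglongrightarrow> N k h powr \<alpha>"
      using N(2)[OF kh] \<alpha> by (intro tendsto_powr' tendsto_const) (auto intro!: always_eventually)
  qed
qed

text \<open>
  Approximating \<open>N\<close> by \<open>m (1 - F)\<close> gives \<open>1 + m (1 - F) = (1 + m) (1 - \<theta> F)\<close> with
  \<open>\<theta> = m / (1 + m) < 1\<close>, and the series for \<open>(1 - z)\<^sup>-\<^sup>q\<close> has positive coefficients.
\<close>

lemma schur_mult_one_plus_neg_powr:
  assumes N: "neg_def I N" "\<And>k h. k \<in> I \<Longrightarrow> h \<in> I \<Longrightarrow> 0 \<le> N k h"
    and q: "0 < q"
  shows "schur_mult I (\<lambda>k h. (1 + N k h) powr (- q))"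
proof (rule schur_mult_limit)
  define F where "F m k h = exp (- (1 / real (Suc m)) * N k h)" for m k h
  define \<theta> where "\<theta> m = real (Suc m) / (1 + real (Suc m))" for m
  have \<theta>: "0 < \<theta> m" "\<theta> m < 1" for m by (simp_all add: \<theta>_def)
  have F: "schur_mult I (F m)" for m
    using N(1) unfolding neg_def_def F_def
    by (elim allE[of _ "1 / real (Suc m)"]) simp
  have F01: "0 < F m k h" "F m k h \<le> 1" if "k \<in> I" "h \<in> I" for m k h
    using N(2)[OF that] unfolding F_def by simp_all
  have \<theta>F: "\<theta> m * F m k h < 1" if "k \<in> I" "h \<in> I" for m k h
    using mult_left_mono[of "F m k h" 1 "\<theta> m"] \<theta>[of m] F01[OF that, of m] by linarith
  have "schur_mult I (\<lambda>k h. (1 - \<theta> m * F m k h) powr (- q))" for m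
  proof (intro schur_mult_one_minus_neg_powr schur_mult_scale F q)
    show "\<bar>\<theta> m * F m k h\<bar> < 1" if "k \<in> I" "h \<in> I" for k h
      using \<theta>F[OF that, of m] F01(1)[OF that, of m] \<theta>(1)[of m] by (simp add: abs_mult)
  qed (use \<theta>(1) in \<open>simp add: less_imp_le\<close>)
  then show "schur_mult I (\<lambda>k h. (1 + real (Suc m)) powr (- q) * (1 - \<theta> m * F m k h) powr (- q))" for m
    by (intro schur_mult_scale) simp_all
  fix k h assume kh: "k \<in> I" "h \<in> I"
  have "(\<lambda>m. (1 + real (Suc m) * (1 - F m k h)) powr (- q)) \<longlonglongrightarrow> (1 + N k h) powr (- q)"
    unfolding F_def using N(2)[OF kh]
    by (intro tendsto_powr tendsto_add scaled_one_minus_exp_tendsto tendsto_const) simp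
  moreover have "1 + real (Suc m) * (1 - F m k h) = (1 + real (Suc m)) * (1 - \<theta> m * F m k h)" for m
    by (simp add: \<theta>_def field_simps)
  ultimately show "(\<lambda>m. (1 + real (Suc m)) powr (- q) * (1 - \<theta> m * F m k h) powr (- q))
      \<longlonglongrightarrow> (1 + N k h) powr (- q)"
    using \<theta>F[OF kh] by (simp add: powr_mult less_imp_le)
qed

text \<open>
  The range \<open>\<gamma> < 2\<close> is that of the powers \<open>\<gamma> / 2 < 1\<close> of the squared distance.
\<close>

lemma neg_def_dist_powr:
  assumes "0 < \<gamma>" "\<gamma> < 2"
  shows "neg_def I (\<lambda>k h. L2_set (\<lambda>i. x k i - x h i) A powr \<gamma>)"
proof -
  have "neg_def I (\<lambda>k h. (\<Sum>i\<in>A. (x k i - x h i)\<^sup>2) powr (\<gamma> / 2))"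
    using assms by (intro neg_def_powr neg_def_dist_squared sum_nonneg) auto
  then show ?thesis
    by (rule neg_def_cong) (simp add: L2_set_def powr_half_sqrt[symmetric] powr_powr sum_nonneg)
qed

section \<open>The derivative of the rescaled Cauchy function\<close>

lemma powr_split_factor:
  fixes u a :: real
  assumes "0 < u"
  shows "u powr a = u powr (a - 1) * u"
  using assms by (simp add: powr_diff)

text \<open>
  \<open>H\<close> is a difference, so its positive definiteness does not come from the two terms. For \<open>y = \<surd>N\<close>,
  the family \<open>b \<mapsto> - H (\<surd>(y\<^sup>2 + b))\<close> has the derivative
  \<open>p (p + 1) / 2 * (1 + \<surd>(y\<^sup>2 + b))\<^sup>-\<^sup>p\<^sup>-\<^sup>2\<close>, a multiplier, and runs from \<open>- H y\<close> to the limit \<open>0\<close>.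
  The assumption concerns \<open>N = y\<^sup>2\<close> instead of \<open>y\<close> because it has to pass to \<open>\<surd>(y\<^sup>2 + b)\<close>.
\<close>

lemma schur_mult_powr_tail:
  fixes p :: real
  defines "H \<equiv> \<lambda>y. (p + 1) * (1 + y) powr (- p) - p * (1 + y) powr (- p - 1)"
  assumes N: "neg_def I N" "\<And>k h. k \<in> I \<Longrightarrow> h \<in> I \<Longrightarrow> 0 \<le> N k h"
    and p: "0 < p"
  shows "schur_mult I (\<lambda>k h. H (sqrt (N k h)))"
proof (rule schur_mult_limit)
  define G where "G b k h = - H (sqrt (N k h + b))" for b k h
  define G' where "G' b k h = p * (p + 1) / 2 * (1 + sqrt (N k h + b)) powr (- (p + 2))" for b k h
  show "schur_mult I (\<lambda>k h. G (real (Suc m)) k h - G 0 k h)" for m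
  proof (rule schur_mult_increment[where G' = G'])
    fix b :: real assume b: "0 < b" "b < real (Suc m)"
    have "neg_def I (\<lambda>k h. (N k h + b) powr (1/2))"
      using b N(2) by (intro neg_def_powr neg_def_add_const N(1)) (auto intro: add_nonneg_nonneg)
    then have "neg_def I (\<lambda>k h. sqrt (N k h + b))"
      by (rule neg_def_cong) (use b N(2) in \<open>auto simp: powr_half_sqrt\<close>)
    then show "schur_mult I (G' b)"
      unfolding G'_def using p b N(2)
      by (intro schur_mult_scale schur_mult_one_plus_neg_powr) (auto intro: add_nonneg_nonneg)
    fix k h assume kh: "k \<in> I" "h \<in> I"
    define r where "r = sqrt (N k h + b)"
    have r: "0 < r" using N(2)[OF kh] b by (simp add: r_def)
    have "(H has_real_derivative (- p * (p + 1) * r * (1 + r) powr (- (p + 2)))) (at r)"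
    proof -
      have "(1 + r) powr (- p - 1) = (1 + r) powr (- p - 1 - 1) * (1 + r)"
        using r by (intro powr_split_factor) simp
      moreover have "(H has_real_derivative
          (p + 1) * (- p * (1 + r) powr (- p - 1)) - p * ((- p - 1) * (1 + r) powr (- p - 1 - 1))) (at r)"
        unfolding H_def using r by (auto intro!: derivative_eq_intros)
      moreover have "- (p + 2) = - p - 1 - 1" by simp
      moreover have "(p + 1) * (- p * (X * (1 + r))) - p * ((- p - 1) * X) = - p * (p + 1) * r * X" for X
        by algebra
      ultimately show ?thesis by metis
    qed
    moreover have "((\<lambda>b. sqrt (N k h + b)) has_real_derivative 1 / (2 * r)) (at b)"
      unfolding r_def using N(2)[OF kh] b by (auto intro!: derivative_eq_intros simp: field_simps)
    ultimately have "((\<lambda>b. H (sqrt (N k h + b))) has_real_derivative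
        (- p * (p + 1) * r * (1 + r) powr (- (p + 2))) * (1 / (2 * r))) (at b)"
      unfolding r_def by (rule DERIV_chain2)
    then have "((\<lambda>b. G b k h) has_real_derivative
        - ((- p * (p + 1) * r * (1 + r) powr (- (p + 2))) * (1 / (2 * r)))) (at b)"
      unfolding G_def by (rule DERIV_minus)
    then show "((\<lambda>b. G b k h) has_real_derivative G' b k h) (at b)"
      using r by (simp add: G'_def r_def[symmetric] mult.assoc)
  next
    fix k h assume kh: "k \<in> I" "h \<in> I"
    have "0 < 1 + sqrt (N k h + b)" if "0 \<le> b" for b
      using N(2)[OF kh] that by (intro add_pos_nonneg) auto
    then have "\<forall>b\<in>{0..real (Suc m)}. 1 + sqrt (N k h + b) \<noteq> 0"
      by fastforce
    then show "continuous_on {0..real (Suc m)} (\<lambda>b. G b k h)"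
      unfolding G_def H_def by (intro continuous_intros)
  qed simp
  fix k h assume kh: "k \<in> I" "h \<in> I"
  have "(H \<longlongrightarrow> (p + 1) * 0 - p * 0) at_top"
    unfolding H_def using p
    by (intro tendsto_intros tendsto_neg_powr filterlim_tendsto_add_at_top[OF tendsto_const] filterlim_ident) auto
  then have "(H \<longlongrightarrow> 0) at_top" by simp
  moreover have "filterlim (\<lambda>m. sqrt (N k h + real (Suc m))) at_top sequentially"
    by (intro filterlim_compose[OF sqrt_at_top] filterlim_tendsto_add_at_top[OF tendsto_const]
        filterlim_compose[OF filterlim_real_sequentially filterlim_Suc])
  ultimately have "(\<lambda>m. H (sqrt (N k h + real (Suc m)))) \<longlonglongrightarrow> 0"
    by (rule filterlim_compose)
  from tendsto_diff[OF tendsto_const this, of "H (sqrt (N k h))"]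
  show "(\<lambda>m. G (real (Suc m)) k h - G 0 k h) \<longlonglongrightarrow> H (sqrt (N k h))"
    by (simp add: G_def)
qed

text \<open>
  With \<open>p = lam / \<delta>\<close> and \<open>y = (t / \<beta>)\<^sup>\<delta>\<close>, this is \<open>\<beta>\<^sup>1\<^sup>-\<^sup>\<epsilon>\<close> times the derivative of \<open>\<beta>\<^sup>\<epsilon> C(t / \<beta>)\<close> with respect to
  \<open>\<beta>\<close>. The term \<open>y (1 + y)\<^sup>-\<^sup>p\<^sup>-\<^sup>1\<close> produced by the chain rule is rewritten as
  \<open>(1 + y)\<^sup>-\<^sup>p - (1 + y)\<^sup>-\<^sup>p\<^sup>-\<^sup>1\<close>.
\<close>

definition scale_deriv :: "real \<Rightarrow> real \<Rightarrow> real \<Rightarrow> real \<Rightarrow> real" where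
  "scale_deriv \<delta> lam \<epsilon> y =
     (\<epsilon> + lam) * (1 + y) powr (- lam / \<delta>) - lam * (1 + y) powr (- lam / \<delta> - 1)"

text \<open>
  The factor \<open>\<sigma>\<close> stands for the sign of \<open>\<epsilon>\<close>: for negative \<open>\<epsilon>\<close> it is the decrease in \<open>\<beta>\<close> that can be
  positive definite. Since \<open>\<beta>\<close> enters \<open>y = (r / \<beta>)\<^sup>\<delta>\<close> through a factor, the derivative is required
  to be a multiplier for all multiples \<open>c\<close> of \<open>r\<^sup>\<delta>\<close>.
\<close>

lemma gen_cauchy_increment:
  assumes "0 < \<delta>" "0 < \<beta>1" "\<beta>1 < \<beta>2"
    and r: "\<And>k j. k \<in> I \<Longrightarrow> j \<in> I \<Longrightarrow> 0 \<le> r k j"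
    and mult: "\<And>c. 0 < c \<Longrightarrow> schur_mult I (\<lambda>k j. \<sigma> * scale_deriv \<delta> lam \<epsilon> (c * r k j powr \<delta>))"
  shows "schur_mult I (\<lambda>k j. \<sigma> * (\<beta>2 powr \<epsilon> * gen_cauchy \<delta> lam (r k j / \<beta>2)
                                - \<beta>1 powr \<epsilon> * gen_cauchy \<delta> lam (r k j / \<beta>1)))"
proof -
  define G where "G b k j = \<sigma> * (b powr \<epsilon> * (1 + b powr (- \<delta>) * r k j powr \<delta>) powr (- lam / \<delta>))" for b k j
  define G' where "G' b k j = b powr (\<epsilon> - 1) * (\<sigma> * scale_deriv \<delta> lam \<epsilon> (b powr (- \<delta>) * r k j powr \<delta>))" for b k j
  have deriv: "((\<lambda>b. G b k j) has_real_derivative G' b k j) (at b)"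
    if b: "0 < b" and kj: "k \<in> I" "j \<in> I" for b k j
  proof -
    define y where "y = b powr (- \<delta>) * r k j powr \<delta>"
    have y: "1 + y > 0" using b by (simp add: y_def add_pos_nonneg)
    have "((\<lambda>b. 1 + b powr (- \<delta>) * r k j powr \<delta>) has_real_derivative (- \<delta> * y / b)) (at b)"
      using b by (auto intro!: derivative_eq_intros simp: y_def powr_diff)
    from DERIV_cmult[OF DERIV_mult[OF has_real_derivative_powr[OF b, of \<epsilon>]
          DERIV_fun_powr[OF this, of "- lam / \<delta>"]], of \<sigma>]
    have "((\<lambda>b. G b k j) has_real_derivative
        \<sigma> * (\<epsilon> * b powr (\<epsilon> - 1) * (1 + y) powr (- lam / \<delta>)
          + (- lam / \<delta>) * (1 + y) powr (- lam / \<delta> - 1) * (- \<delta> * y / b) * b powr \<epsilon>)) (at b)"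
      using y unfolding G_def y_def by simp
    moreover have "b powr \<epsilon> = b powr (\<epsilon> - 1) * b"
      using b by (rule powr_split_factor)
    moreover have "(1 + y) powr (- lam / \<delta>) = (1 + y) powr (- lam / \<delta> - 1) * (1 + y)"
      using y by (rule powr_split_factor)
    ultimately show ?thesis
      using b \<open>0 < \<delta>\<close> unfolding G'_def scale_deriv_def y_def[symmetric]
      by (simp add: algebra_simps)
  qed
  have "schur_mult I (\<lambda>k j. G \<beta>2 k j - G \<beta>1 k j)"
  proof (rule schur_mult_increment[where G' = G'])
    show "schur_mult I (G' b)" if "\<beta>1 < b" for b
      unfolding G'_def using that \<open>0 < \<beta>1\<close> by (intro schur_mult_scale mult) simp_all
    show "continuous_on {\<beta>1..\<beta>2} (\<lambda>b. G b k j)" if "k \<in> I" "j \<in> I" for k j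
    proof (intro continuous_at_imp_continuous_on ballI)
      fix b assume "b \<in> {\<beta>1..\<beta>2}"
      then show "isCont (\<lambda>b. G b k j) b"
        using \<open>0 < \<beta>1\<close> by (intro DERIV_isCont[OF deriv[OF _ that]]) auto
    qed
  qed (use assms deriv in auto)
  then show ?thesis
  proof (rule schur_mult_cong)
    fix k j assume kj: "k \<in> I" "j \<in> I"
    have "gen_cauchy \<delta> lam (r k j / b) = (1 + b powr (- \<delta>) * r k j powr \<delta>) powr (- lam / \<delta>)"
      if "0 < b" for b
      unfolding gen_cauchy_def using that r[OF kj]
      by (simp add: powr_divide powr_minus field_simps)
    then show "G \<beta>2 k j - G \<beta>1 k j = \<sigma> * (\<beta>2 powr \<epsilon> * gen_cauchy \<delta> lam (r k j / \<beta>2)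
                                - \<beta>1 powr \<epsilon> * gen_cauchy \<delta> lam (r k j / \<beta>1))"
      using assms(2,3) by (simp add: G_def right_diff_distrib)
  qed
qed

section \<open>Functions that are positive definite in all dimensions\<close>

lemma Phi_infI:
  assumes "continuous_on {0..} \<phi>" "\<phi> 0 = 1"
    and "\<And>n N (x :: nat \<Rightarrow> nat \<Rightarrow> real).
        psd {..<N} (\<lambda>k h. \<phi> (L2_set (\<lambda>i. x k i - x h i) {..<n}))"
  shows "\<phi> \<in> Phi_inf"
  using assms(1,2) assms(3)[unfolded psd_def]
  by (auto simp: Phi_inf_def Phi_def positive_definite_on_def)

text \<open>
  The points \<open>(t / \<surd>2) e\<^sub>k\<close> of \<open>R\<^sup>n\<close> have mutual distance \<open>t\<close>. With all coefficients equal to 1, the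
  quadratic form is \<open>n (1 + (n - 1) \<phi> t)\<close>, so \<open>\<phi> t \<ge> - 1 / (n - 1)\<close> for every \<open>n > 1\<close>.
\<close>

lemma Phi_inf_nonneg:
  assumes "\<phi> \<in> Phi_inf" "0 \<le> t"
  shows "0 \<le> \<phi> t"
proof -
  have bound: "0 \<le> 1 + real m * \<phi> t" for m
  proof -
    define n where "n = Suc m"
    define x :: "nat \<Rightarrow> nat \<Rightarrow> real" where "x k i = (if i = k then t / sqrt 2 else 0)" for k i
    have \<phi>: "\<phi> 0 = 1" "positive_definite_on n (\<lambda>x. \<phi> (L2_set x {..<n}))"
      using assms(1) by (auto simp: Phi_inf_def Phi_def n_def)
    have dist: "L2_set (\<lambda>i. x k i - x h i) {..<n} = (if k = h then 0 else t)"
      if "k < n" "h < n" for k h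
    proof (cases "k = h")
      case False
      have "(x k i - x h i)\<^sup>2 = (if i = k then t\<^sup>2 / 2 else 0) + (if i = h then t\<^sup>2 / 2 else 0)" for i
        using False by (auto simp: x_def power_divide)
      then have "(\<Sum>i<n. (x k i - x h i)\<^sup>2) = t\<^sup>2"
        using that by (simp add: sum.distrib)
      then show ?thesis using False assms(2) by (simp add: L2_set_def)
    qed (simp add: L2_set_def)
    have "\<forall>k<n. x k \<in> topspace (Euclidean_space n)"
      by (auto simp: topspace_Euclidean_space x_def)
    then have "0 \<le> (\<Sum>k<n. \<Sum>h<n. 1 * \<phi> (L2_set (\<lambda>i. x k i - x h i) {..<n}) * 1)"
      using \<phi>(2)[unfolded positive_definite_on_def, rule_format, of n x "\<lambda>_. 1"] by blast
    also have "\<dots> = (\<Sum>k<n. \<Sum>h<n. \<phi> t + (if h = k then 1 - \<phi> t else 0))"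
      by (intro sum.cong refl) (auto simp: dist \<phi>(1))
    also have "\<dots> = real n * (1 + real m * \<phi> t)"
      by (simp add: sum.distrib n_def algebra_simps)
    finally show ?thesis
      by (simp add: n_def zero_le_mult_iff)
  qed
  show ?thesis
  proof (rule ccontr)
    assume neg: "\<not> 0 \<le> \<phi> t"
    obtain m where "1 / (- \<phi> t) < real m" using reals_Archimedean2 by blast
    then have "1 < real m * (- \<phi> t)" using neg by (simp add: field_simps)
    with bound[of m] show False by simp
  qed
qed

text \<open>
  For \<open>t > 0\<close> the product equals \<open>(t\<^sup>-\<^sup>\<delta> + \<beta>\<^sup>-\<^sup>\<delta>)\<^sup>-\<^sup>p\<close> with \<open>p = lam / \<delta>\<close>.
\<close>

lemma gen_cauchy_tail:
  assumes "0 < \<delta>" "0 < \<beta>"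
  shows "((\<lambda>t. t powr lam * gen_cauchy \<delta> lam (t / \<beta>)) \<longlongrightarrow> \<beta> powr lam) at_top"
proof -
  have "((\<lambda>t. (t powr (- \<delta>) + \<beta> powr (- \<delta>)) powr (- lam / \<delta>))
      \<longlongrightarrow> (0 + \<beta> powr (- \<delta>)) powr (- lam / \<delta>)) at_top"
    using assms by (intro tendsto_powr tendsto_add tendsto_neg_powr filterlim_ident tendsto_const) auto
  moreover have "(0 + \<beta> powr (- \<delta>)) powr (- lam / \<delta>) = \<beta> powr lam"
    using assms by (simp add: powr_powr)
  moreover have "\<forall>\<^sub>F t in at_top. (t powr (- \<delta>) + \<beta> powr (- \<delta>)) powr (- lam / \<delta>)
      = t powr lam * gen_cauchy \<delta> lam (t / \<beta>)"
    using eventually_gt_at_top[of 0]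
  proof eventually_elim
    case (elim t)
    have "t powr (- \<delta>) + \<beta> powr (- \<delta>) = t powr (- \<delta>) * (1 + (t / \<beta>) powr \<delta>)"
      using elim assms by (simp add: powr_divide powr_minus field_simps)
    moreover have "(t powr (- \<delta>)) powr (- lam / \<delta>) = t powr lam"
      using assms by (simp add: powr_powr)
    ultimately show ?case
      by (simp add: gen_cauchy_def powr_mult add_nonneg_nonneg)
  qed
  ultimately show ?thesis by (simp add: tendsto_cong)
qed

text \<open>
  Multiplied by \<open>t powr lam\<close>, the difference of the two sides tends to
  \<open>\<beta>2 powr (\<epsilon> + lam) - \<beta>1 powr (\<epsilon> + lam)\<close>, which is positive.
\<close>

lemma gen_cauchy_difference_eventually_pos:
  assumes "0 < \<delta>" "0 < \<beta>1" "\<beta>1 < \<beta>2" "- lam < \<epsilon>"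
  shows "\<forall>\<^sub>F t in at_top. \<beta>1 powr \<epsilon> * gen_cauchy \<delta> lam (t / \<beta>1) < \<beta>2 powr \<epsilon> * gen_cauchy \<delta> lam (t / \<beta>2)"
proof -
  let ?D = "\<lambda>t. \<beta>2 powr \<epsilon> * gen_cauchy \<delta> lam (t / \<beta>2) - \<beta>1 powr \<epsilon> * gen_cauchy \<delta> lam (t / \<beta>1)"
  have "((\<lambda>t. \<beta>2 powr \<epsilon> * (t powr lam * gen_cauchy \<delta> lam (t / \<beta>2))
          - \<beta>1 powr \<epsilon> * (t powr lam * gen_cauchy \<delta> lam (t / \<beta>1)))
      \<longlongrightarrow> \<beta>2 powr \<epsilon> * \<beta>2 powr lam - \<beta>1 powr \<epsilon> * \<beta>1 powr lam) at_top"
    using assms by (intro tendsto_diff tendsto_mult tendsto_const gen_cauchy_tail) auto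
  then have "((\<lambda>t. t powr lam * ?D t) \<longlongrightarrow> \<beta>2 powr (\<epsilon> + lam) - \<beta>1 powr (\<epsilon> + lam)) at_top"
    by (simp add: algebra_simps powr_add)
  moreover have "\<beta>1 powr (\<epsilon> + lam) < \<beta>2 powr (\<epsilon> + lam)"
    using assms by (intro powr_less_mono2) auto
  ultimately have "\<forall>\<^sub>F t in at_top. 0 < t powr lam * ?D t"
    by (intro order_tendstoD(1)) auto
  then show ?thesis
    by eventually_elim (auto simp: zero_less_mult_iff)
qed

section \<open>The operator on the Cauchy function\<close>

text \<open>
  The normalising factor \<open>\<beta>2\<^sup>\<epsilon> - \<beta>1\<^sup>\<epsilon>\<close> has the sign of \<open>\<epsilon>\<close>, which is why the criterion involves
  \<open>sgn \<epsilon>\<close>.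
\<close>

lemma K_op_gen_cauchy_in_Phi_inf:
  assumes "0 < \<delta>" "0 < \<beta>1" "\<beta>1 < \<beta>2" "\<epsilon> \<noteq> 0"
    and mult: "\<And>c n N (x :: nat \<Rightarrow> nat \<Rightarrow> real). 0 < c \<Longrightarrow>
        schur_mult {..<N} (\<lambda>k j. sgn \<epsilon> * scale_deriv \<delta> lam \<epsilon> (c * L2_set (\<lambda>i. x k i - x j i) {..<n} powr \<delta>))"
  shows "K_op \<epsilon> \<beta>2 \<beta>1 (gen_cauchy \<delta> lam) \<in> Phi_inf"
proof (rule Phi_infI)
  have D: "0 < sgn \<epsilon> * (\<beta>2 powr \<epsilon> - \<beta>1 powr \<epsilon>)"
    using assms(2-4) by (auto simp: sgn_if intro: powr_less_mono2 powr_less_mono2_neg)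
  then have D0: "\<beta>2 powr \<epsilon> - \<beta>1 powr \<epsilon> \<noteq> 0" by auto
  show "K_op \<epsilon> \<beta>2 \<beta>1 (gen_cauchy \<delta> lam) 0 = 1"
    using D0 by (simp add: K_op_def gen_cauchy_def)
  have cont: "continuous_on {0..} (\<lambda>t. gen_cauchy \<delta> lam (t / \<beta>))" if "0 < \<beta>" for \<beta>
    unfolding gen_cauchy_def using that \<open>0 < \<delta>\<close>
    by (intro continuous_intros continuous_on_powr')
       (auto simp: add_nonneg_eq_0_iff intro: add_nonneg_nonneg)
  show "continuous_on {0..} (K_op \<epsilon> \<beta>2 \<beta>1 (gen_cauchy \<delta> lam))"
    unfolding K_op_def using assms(2,3) D0 by (intro continuous_intros cont) auto
  fix n N and x :: "nat \<Rightarrow> nat \<Rightarrow> real"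
  define r where "r k j = L2_set (\<lambda>i. x k i - x j i) {..<n}" for k j
  have "schur_mult {..<N} (\<lambda>k j. sgn \<epsilon> * (\<beta>2 powr \<epsilon> * gen_cauchy \<delta> lam (r k j / \<beta>2)
             - \<beta>1 powr \<epsilon> * gen_cauchy \<delta> lam (r k j / \<beta>1)))"
    using assms(1-3) mult unfolding r_def
    by (intro gen_cauchy_increment) auto
  from schur_mult_scale[OF less_imp_le[OF divide_pos_pos[OF zero_less_one D]] this]
  have "schur_mult {..<N} (\<lambda>k j. K_op \<epsilon> \<beta>2 \<beta>1 (gen_cauchy \<delta> lam) (r k j))"
    using \<open>\<epsilon> \<noteq> 0\<close> by (simp add: K_op_def sgn_zero_iff)
  then show "psd {..<N} (\<lambda>k j. K_op \<epsilon> \<beta>2 \<beta>1 (gen_cauchy \<delta> lam) (L2_set (\<lambda>i. x k i - x j i) {..<n}))"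
    unfolding r_def by (rule schur_mult_imp_psd)
qed

theorem theorem3p3:
  fixes d :: nat and \<delta> lam \<beta>1 \<beta>2 \<epsilon> :: real
  assumes "d \<ge> 1"
    and "0 < \<delta>" and "\<delta> < 2"
    and "lam > real d"
    and "0 < \<beta>1" and "\<beta>1 < \<beta>2"
    and "\<epsilon> \<noteq> 0"
  shows "(\<epsilon> > 0 \<longrightarrow> \<epsilon> \<ge> \<delta> \<and> \<delta> < 1 \<longrightarrow>
            K_op \<epsilon> \<beta>2 \<beta>1 (gen_cauchy \<delta> lam) \<in> Phi_inf) \<and>
         (\<epsilon> < 0 \<longrightarrow>
            (K_op \<epsilon> \<beta>2 \<beta>1 (gen_cauchy \<delta> lam) \<in> Phi_inf \<longleftrightarrow> \<epsilon> \<le> - lam))"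
proof (intro conjI impI iffI)
  have lam: "0 < lam" using assms by simp
  have cauchy: "schur_mult I (\<lambda>k j. (1 + c * L2_set (\<lambda>i. x k i - x j i) A powr \<delta>) powr (- q))"
    if "0 < c" "0 < q" for I :: "nat set" and c q A and x :: "nat \<Rightarrow> nat \<Rightarrow> real"
    using that assms(2,3) by (intro schur_mult_one_plus_neg_powr neg_def_scale neg_def_dist_powr) auto
  {
    assume "0 < \<epsilon>" and \<epsilon>: "\<delta> \<le> \<epsilon> \<and> \<delta> < 1"
    show "K_op \<epsilon> \<beta>2 \<beta>1 (gen_cauchy \<delta> lam) \<in> Phi_inf"
    proof (rule K_op_gen_cauchy_in_Phi_inf)
      fix c :: real and n N and x :: "nat \<Rightarrow> nat \<Rightarrow> real"
      assume c: "0 < c"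
      define p where "p = lam / \<delta>"
      have p: "0 < p" "- lam / \<delta> = - p" "lam = \<delta> * p" using lam assms(2) by (simp_all add: p_def)
      define y where "y k j = c * L2_set (\<lambda>i. x k i - x j i) {..<n} powr \<delta>" for k j
      \<comment> \<open>The exponent \<open>2 * \<delta>\<close> is below 2 exactly because \<open>\<delta> < 1\<close>.\<close>
      have "neg_def {..<N} (\<lambda>k j. c\<^sup>2 * L2_set (\<lambda>i. x k i - x j i) {..<n} powr (2 * \<delta>))"
        using \<epsilon> assms(2) by (intro neg_def_scale neg_def_dist_powr) auto
      moreover have "(z powr \<delta>)\<^sup>2 = z powr (2 * \<delta>)" for z :: real
        by (simp add: power2_eq_square flip: powr_add)
      ultimately have "neg_def {..<N} (\<lambda>k j. (y k j)\<^sup>2)"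
        by (simp add: y_def power_mult_distrib)
      from schur_mult_powr_tail[OF this _ p(1)]
      have "schur_mult {..<N} (\<lambda>k j. (p + 1) * (1 + y k j) powr (- p) - p * (1 + y k j) powr (- p - 1))"
        using c by (simp add: y_def)
      moreover have "schur_mult {..<N} (\<lambda>k j. (1 + y k j) powr (- p))"
        unfolding y_def using c p(1) by (rule cauchy)
      ultimately have "schur_mult {..<N} (\<lambda>k j. (\<epsilon> - \<delta>) * (1 + y k j) powr (- p)
          + \<delta> * ((p + 1) * (1 + y k j) powr (- p) - p * (1 + y k j) powr (- p - 1)))"
        \<comment> \<open>The first coefficient is where \<open>\<epsilon> \<ge> \<delta>\<close> enters.\<close>
        using \<epsilon> assms(2) by (intro schur_mult_add schur_mult_scale) auto
      then show "schur_mult {..<N} (\<lambda>k j. sgn \<epsilon> *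
          scale_deriv \<delta> lam \<epsilon> (c * L2_set (\<lambda>i. x k i - x j i) {..<n} powr \<delta>))"
        unfolding scale_deriv_def p(2) y_def[symmetric] using \<open>0 < \<epsilon>\<close>
        by (simp add: p(3)) (simp add: algebra_simps)
    qed (use assms in auto)
  next
    assume "\<epsilon> < 0" and \<epsilon>: "\<epsilon> \<le> - lam"
    show "K_op \<epsilon> \<beta>2 \<beta>1 (gen_cauchy \<delta> lam) \<in> Phi_inf"
    proof (rule K_op_gen_cauchy_in_Phi_inf)
      fix c :: real and n N and x :: "nat \<Rightarrow> nat \<Rightarrow> real"
      assume c: "0 < c"
      define y where "y k j = c * L2_set (\<lambda>i. x k i - x j i) {..<n} powr \<delta>" for k j
      have "schur_mult {..<N} (\<lambda>k j. - (\<epsilon> + lam) * (1 + y k j) powr (- (lam / \<delta>))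
          + lam * (1 + y k j) powr (- (lam / \<delta> + 1)))"
        unfolding y_def using \<epsilon> assms(2) c lam
        by (intro schur_mult_add schur_mult_scale cauchy) (auto intro: add_pos_pos)
      moreover have "- (lam / \<delta>) = - lam / \<delta>" "- (lam / \<delta> + 1) = - lam / \<delta> - 1"
        by simp_all
      ultimately have "schur_mult {..<N} (\<lambda>k j. - (\<epsilon> + lam) * (1 + y k j) powr (- lam / \<delta>)
          + lam * (1 + y k j) powr (- lam / \<delta> - 1))"
        by (simp only:)
      then show "schur_mult {..<N} (\<lambda>k j. sgn \<epsilon> *
          scale_deriv \<delta> lam \<epsilon> (c * L2_set (\<lambda>i. x k i - x j i) {..<n} powr \<delta>))"
        unfolding scale_deriv_def y_def[symmetric] using \<open>\<epsilon> < 0\<close> by (simp add: algebra_simps)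
    qed (use assms in auto)
  next
    assume "\<epsilon> < 0" and K: "K_op \<epsilon> \<beta>2 \<beta>1 (gen_cauchy \<delta> lam) \<in> Phi_inf"
    show "\<epsilon> \<le> - lam"
    proof (rule ccontr)
      assume "\<not> \<epsilon> \<le> - lam"
      then have "\<forall>\<^sub>F t in at_top. \<beta>1 powr \<epsilon> * gen_cauchy \<delta> lam (t / \<beta>1)
          < \<beta>2 powr \<epsilon> * gen_cauchy \<delta> lam (t / \<beta>2)"
        using assms by (intro gen_cauchy_difference_eventually_pos) auto
      then obtain t where t: "0 \<le> t" "\<beta>1 powr \<epsilon> * gen_cauchy \<delta> lam (t / \<beta>1)
          < \<beta>2 powr \<epsilon> * gen_cauchy \<delta> lam (t / \<beta>2)"
        using eventually_happens'[OF trivial_limit_at_top_linorder eventually_conj[OF eventually_ge_at_top[of 0]]]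
        by blast
      moreover have "\<beta>2 powr \<epsilon> < \<beta>1 powr \<epsilon>"
        using assms \<open>\<epsilon> < 0\<close> by (intro powr_less_mono2_neg) auto
      ultimately have "K_op \<epsilon> \<beta>2 \<beta>1 (gen_cauchy \<delta> lam) t < 0"
        by (simp add: K_op_def divide_pos_neg)
      with Phi_inf_nonneg[OF K t(1)] show False by simp
    qed
  }
qed

end
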